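(* Let $p>1$ and $\mu>0$. Let $F$ be a differentiable function on the general convex set $K_g$. Then $F$ is a higher order strongly general convex function (with constant $\mu$) if and only if $$F(g(v))-F(g(u))\ge\langle F'(g(u)),\,g(v)-g(u)\rangle+\mu\,\|g(v)-g(u)\|^p\qquad\text{for all } g(u),g(v)\in K_g .$$
   Context: $H$ is a real Hilbert space with inner product $\langle\cdot,\cdot\rangle$ and norm $\|\cdot\|$, and $g:H\to H$ is an arbitrary function. $K_g\subseteq H$ is a general convex set with respect to $g$: $g(u)+t(g(v)-g(u))\in K_g$ for all $u,v\in H$ with $g(u),g(v)\in K_g$ and all $t\in[0,1]$. As a standing assumption $g$ is onto $K_g$ (every point of $K_g$ is $g(v)$ for some $v\in H$). "For all $g(u),g(v)\in K_g$" means for all $u,v\in H$ with $g(u),g(v)\in K_g$. For $p>1$ and $\mu>0$, a real-valued function $F$ on $K_g$ is higher order strongly general convex with constant $\mu$ if $$F\big(g(u)+t(g(v)-g(u))\big)\le(1-t)F(g(u))+tF(g(v))-\mu\{t^p(1-t)+t(1-t)^p\}\|g(v)-g(u)\|^p$$ for all $g(u),g(v)\in K_g$ and $t\in[0,1]$. "Differentiable" means Fréchet differentiable at the points of $K_g$ ($F$ being understood as defined near $K_g$), with $F'$ identified with an element of $H$. *)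

theory Defs
  imports "HOL-Analysis.Analysis"
begin

definition general_convex :: "('a::real_vector \<Rightarrow> 'a) \<Rightarrow> 'a set \<Rightarrow> bool" where
  "general_convex g K \<longleftrightarrow>
     (\<forall>u v. g u \<in> K \<longrightarrow> g v \<in> K \<longrightarrow>
        (\<forall>t\<in>{0..1}. g u + t *\<^sub>R (g v - g u) \<in> K))"

definition higher_order_strongly_general_convex ::
    "real \<Rightarrow> real \<Rightarrow> ('a::real_normed_vector \<Rightarrow> 'a) \<Rightarrow> 'a set \<Rightarrow> ('a \<Rightarrow> real) \<Rightarrow> bool" where
  "higher_order_strongly_general_convex p \<mu> g K F \<longleftrightarrow>
     (\<forall>u v. g u \<in> K \<longrightarrow> g v \<in> K \<longrightarrow>
        (\<forall>t\<in>{0..1}.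
           F (g u + t *\<^sub>R (g v - g u))
             \<le> (1 - t) * F (g u) + t * F (g v)
               - \<mu> * (t powr p * (1 - t) + t * (1 - t) powr p) * norm (g v - g u) powr p))"

(* The Frechet derivative, identified with a vector. The vector is unique if it exists;
   on a Hilbert space it exists at every point of differentiability (Riesz). *)
definition gradient :: "('a::real_inner \<Rightarrow> real) \<Rightarrow> 'a \<Rightarrow> 'a" where
  "gradient F x = (THE D. GDERIV F x :> D)"

lemma gradient_eqI:
  assumes "GDERIV F x :> D"
  shows "gradient F x = D"
  unfolding gradient_def
proof (rule the_equality)
  show "GDERIV F x :> D" by (rule assms)
next
  fix E assume "GDERIV F x :> E"
  then have "(\<lambda>h. inner h E) = (\<lambda>h. inner h D)"
    using assms unfolding gderiv_def by (rule has_derivative_unique)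
  then have "inner h E = inner h D" for h by (rule fun_cong)
  then have "inner (E - D) (E - D) = 0" by (simp add: inner_diff_right)
  then show "E = D" by simp
qed

end

theory Submission
  imports Defs
begin

text \<open>
  Write \<open>x = g u\<close>, \<open>y = g v\<close>, \<open>d = y - x\<close>; since \<open>g\<close> is onto \<open>K\<close>, both conditions speak
  about pairs of points of \<open>K\<close>, and general convexity is ordinary convexity of \<open>K\<close>.

  If \<open>F\<close> is strongly convex, subtract \<open>F x\<close> in the defining inequality, divide by \<open>t > 0\<close> and
  let \<open>t\<close> tend to 0. The difference quotient tends to the directional derivative
  \<open>\<langle>F'(x), d\<rangle>\<close>, and the weight \<open>t\<^sup>p\<^sup>-\<^sup>1(1-t) + (1-t)\<^sup>p\<close> of the penalty tends to 1 because
  \<open>p > 1\<close> (lemma \<open>gradient_inequality_of_segment_inequality\<close>).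

  Conversely, apply the gradient inequality at the intermediate point \<open>z = x + t d\<close> to both
  endpoints. As \<open>y - z = (1-t) d\<close> and \<open>x - z = -t d\<close>, weighting the two inequalities with \<open>t\<close>
  and \<open>1-t\<close> cancels the gradient terms and leaves exactly the required penalty
  (lemma \<open>segment_inequality_of_gradient_inequalities\<close>).

  That the derivative is represented by a gradient vector at all is the Riesz representation
  theorem, obtained by minimising the strictly convex functional \<open>\<parallel>x\<parallel>\<^sup>2/2 - f x\<close>, whose
  critical point represents \<open>f\<close> (lemma \<open>riesz_representation\<close>).
\<close>

text \<open>
  Completing the square: \<open>\<parallel>x\<parallel>\<^sup>2/2 - C\<parallel>x\<parallel> \<ge> -C\<^sup>2/2\<close> for an operator bound \<open>C\<close> of \<open>f\<close>. By the
  parallelogram law a minimising sequence is then a Cauchy sequence, so completeness yields a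
  minimiser.
\<close>

lemma quadratic_functional_attains_minimum:
  fixes f :: "'a::{real_inner, complete_space} \<Rightarrow> real"
  assumes "bounded_linear f"
  shows "\<exists>x. \<forall>y. (norm x)\<^sup>2 / 2 - f x \<le> (norm y)\<^sup>2 / 2 - f y"
proof -
  interpret f: bounded_linear f by fact
  define Q where "Q x = (norm x)\<^sup>2 / 2 - f x" for x
  obtain C where C: "\<And>x. norm (f x) \<le> norm x * C"
    using f.bounded by blast
  have "Q x \<ge> - C\<^sup>2 / 2" for x
  proof -
    have "f x \<le> norm x * C" using C[of x] by simp
    moreover have "0 \<le> (norm x - C)\<^sup>2" by simp
    ultimately show ?thesis unfolding Q_def by (simp add: power2_diff)
  qed
  then have bdd: "bdd_below (range Q)" by (intro bdd_belowI2)
  define m where "m = Inf (range Q)"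
  have m_le: "m \<le> Q x" for x unfolding m_def by (rule cInf_lower[OF _ bdd]) simp
  have parallelogram: "(norm (x - y))\<^sup>2 = 4 * (Q x + Q y) - 8 * Q ((1/2) *\<^sub>R (x + y))" for x y
    unfolding Q_def
    by (simp add: f.scaleR f.add power2_norm_eq_inner algebra_simps inner_commute)
  have "\<exists>x. Q x < m + inverse (real (Suc n))" for n
  proof -
    have "Inf (range Q) < m + inverse (real (Suc n))" unfolding m_def by simp
    then show ?thesis using cInf_lessD[of "range Q"] by blast
  qed
  then obtain X where X: "\<And>n. Q (X n) < m + inverse (real (Suc n))" by metis
  have "Cauchy X"
  proof (rule metric_CauchyI)
    fix e :: real assume "e > 0"
    then obtain M where M: "inverse (real (Suc M)) < e\<^sup>2 / 8"
      using reals_Archimedean[of "e\<^sup>2 / 8"] by auto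
    have "dist (X i) (X j) < e" if "i \<ge> M" "j \<ge> M" for i j
    proof -
      have near: "Q (X k) < m + e\<^sup>2 / 8" if "k \<ge> M" for k
      proof -
        have "inverse (real (Suc k)) \<le> inverse (real (Suc M))" using that by simp
        then show ?thesis using X[of k] M by linarith
      qed
      define mid where "mid = (1/2) *\<^sub>R (X i + X j)"
      have "(norm (X i - X j))\<^sup>2 = 4 * (Q (X i) + Q (X j)) - 8 * Q mid"
        unfolding mid_def by (rule parallelogram)
      then have "(norm (X i - X j))\<^sup>2 < e\<^sup>2"
        using near[OF \<open>i \<ge> M\<close>] near[OF \<open>j \<ge> M\<close>] m_le[of mid]
        by (simp add: field_simps)
      then show ?thesis
        using \<open>e > 0\<close> power2_less_imp_less[of "norm (X i - X j)" e] by (simp add: dist_norm)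
    qed
    then show "\<exists>M. \<forall>i\<ge>M. \<forall>j\<ge>M. dist (X i) (X j) < e" by blast
  qed
  then obtain x where lim: "X \<longlonglongrightarrow> x"
    using Cauchy_convergent_iff convergent_def by blast
  have "(\<lambda>n. Q (X n)) \<longlonglongrightarrow> Q x"
    unfolding Q_def by (intro tendsto_intros f.tendsto lim) simp
  moreover have "(\<lambda>n. m + inverse (real (Suc n))) \<longlonglongrightarrow> m"
    by (rule LIMSEQ_inverse_real_of_nat_add)
  ultimately have "Q x \<le> m"
    using X by (intro LIMSEQ_le) (auto intro: less_imp_le)
  then have "Q x \<le> Q y" for y using m_le[of y] by linarith
  then show ?thesis unfolding Q_def by blast
qed

lemma riesz_representation:
  fixes f :: "'a::{real_inner, complete_space} \<Rightarrow> real"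
  assumes "bounded_linear f"
  obtains D where "f = (\<lambda>h. inner h D)"
proof -
  interpret f: bounded_linear f by fact
  obtain D where D: "\<And>y. (norm D)\<^sup>2 / 2 - f D \<le> (norm y)\<^sup>2 / 2 - f y"
    using quadratic_functional_attains_minimum[OF assms] by blast
  have "f h = inner h D" for h
  proof -
    define b where "b = (norm h)\<^sup>2 / 2"
    define c where "c = inner h D - f h"
    define t where "t = - c / (1 + b)"
    have "b \<ge> 0" by (simp add: b_def)
    have "(norm (D + t *\<^sub>R h))\<^sup>2 = (norm D)\<^sup>2 + 2 * (t * inner h D) + t\<^sup>2 * (norm h)\<^sup>2"
      unfolding power2_norm_eq_inner
      by (simp add: inner_add_left inner_add_right inner_commute power2_eq_square)
    then have "0 \<le> t * c + t\<^sup>2 * b"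
      using D[of "D + t *\<^sub>R h"] unfolding b_def c_def
      by (simp add: f.scaleR f.add field_simps)
    \<comment> \<open>A first-order term \<open>c \<noteq> 0\<close> would make the small step \<open>t\<close> decrease the functional.\<close>
    also have "t * c + t\<^sup>2 * b = - (c / (1 + b))\<^sup>2"
      using \<open>b \<ge> 0\<close> unfolding t_def
      by (simp add: divide_simps power2_eq_square add_nonneg_eq_0_iff) (simp add: algebra_simps)
    finally have "c / (1 + b) = 0" by simp
    then show ?thesis using \<open>b \<ge> 0\<close> by (auto simp: c_def)
  qed
  then show thesis using that[of D] by blast
qed

lemma GDERIV_gradient:
  fixes F :: "'a::{real_inner, complete_space} \<Rightarrow> real"
  assumes "F differentiable (at x)"
  shows "GDERIV F x :> gradient F x"
proof -
  obtain F' where F': "(F has_derivative F') (at x)"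
    using assms unfolding differentiable_def by blast
  then obtain D where "F' = (\<lambda>h. inner h D)"
    using riesz_representation has_derivative_bounded_linear by blast
  then have "GDERIV F x :> D" using F' by (simp add: gderiv_def)
  then show ?thesis by (simp add: gradient_eqI)
qed

text \<open>
  Only the limit \<open>t \<rightarrow> 0\<close> from the right matters: there \<open>t\<^sup>p/t\<close> vanishes because \<open>p > 1\<close>, so of the
  two penalty terms just \<open>(1-t)\<^sup>p\<close> survives and contributes the full \<open>\<mu>\<parallel>y - x\<parallel>\<^sup>p\<close>.
\<close>

lemma gradient_inequality_of_segment_inequality:
  fixes F :: "'a::real_inner \<Rightarrow> real"
  assumes "p > 1"
    and deriv: "GDERIV F x :> D"
    and segment: "\<And>t. 0 < t \<Longrightarrow> t < 1 \<Longrightarrow>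
      F (x + t *\<^sub>R (y - x)) \<le> (1 - t) * F x + t * F y
        - \<mu> * (t powr p * (1 - t) + t * (1 - t) powr p) * norm (y - x) powr p"
  shows "F y - F x \<ge> inner D (y - x) + \<mu> * norm (y - x) powr p"
proof -
  define N where "N = norm (y - x) powr p"
  have "((\<lambda>t. F (x + t *\<^sub>R (y - x))) has_derivative (\<lambda>t. inner (t *\<^sub>R (y - x)) D)) (at 0)"
    using deriv unfolding gderiv_def
    by (intro has_derivative_compose[where g = F and f = "\<lambda>t. x + t *\<^sub>R (y - x)"])
       (auto intro!: derivative_eq_intros)
  moreover have "(\<lambda>t. inner (t *\<^sub>R (y - x)) D) = (*) (inner D (y - x))"
    by (simp add: fun_eq_iff inner_commute)
  ultimately have "((\<lambda>t. F (x + t *\<^sub>R (y - x))) has_field_derivative inner D (y - x)) (at 0)"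
    by (simp add: has_field_derivative_def)
  then have "((\<lambda>t. (F (x + t *\<^sub>R (y - x)) - F x) / t) \<longlongrightarrow> inner D (y - x)) (at_right 0)"
    by (intro filterlim_mono[OF _ order_refl at_le[of "{0<..}" UNIV]]) (simp_all add: DERIV_def)
  moreover have "((\<lambda>t. F y - F x - \<mu> * (t powr (p - 1) * (1 - t) + (1 - t) powr p) * N)
      \<longlongrightarrow> F y - F x - \<mu> * (0 * (1 - 0) + (1 - 0) powr p) * N) (at_right 0)"
    using \<open>p > 1\<close>
    by (intro tendsto_intros tendsto_zero_powrI[where b = "p - 1"] tendsto_powr)
       (auto simp: eventually_at_filter)
  moreover have "eventually (\<lambda>t. (F (x + t *\<^sub>R (y - x)) - F x) / t
      \<le> F y - F x - \<mu> * (t powr (p - 1) * (1 - t) + (1 - t) powr p) * N) (at_right 0)"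
    using eventually_at_right_real[of 0 1, simplified]
  proof eventually_elim
    case (elim t)
    then have "t powr p = t * t powr (p - 1)"
      using powr_mult_base[of t "p - 1"] by simp
    then have "F (x + t *\<^sub>R (y - x)) - F x
        \<le> t * (F y - F x - \<mu> * (t powr (p - 1) * (1 - t) + (1 - t) powr p) * N)"
      using segment[of t] elim unfolding N_def by (simp add: algebra_simps)
    then show ?case using elim by (simp add: divide_le_eq mult.commute)
  qed
  ultimately have "inner D (y - x) \<le> F y - F x - \<mu> * (0 * (1 - 0) + (1 - 0) powr p) * N"
    by (intro tendsto_le[OF trivial_limit_at_right_real])
  then show ?thesis by (simp add: N_def)
qed

text \<open>
  The vector \<open>D\<close> may be any common slope at the intermediate point: it enters the two
  inequalities with the opposite directions \<open>(1-t)(y - x)\<close> and \<open>-t(y - x)\<close>, whose convex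
  combination with weights \<open>t\<close> and \<open>1-t\<close> is zero.
\<close>

lemma segment_inequality_of_gradient_inequalities:
  fixes F :: "'a::real_inner \<Rightarrow> real" and x y D :: 'a
  defines "z t \<equiv> x + t *\<^sub>R (y - x)"
  assumes t: "0 \<le> t" "t \<le> 1"
    and to_y: "F y - F (z t) \<ge> inner D (y - z t) + \<mu> * norm (y - z t) powr p"
    and to_x: "F x - F (z t) \<ge> inner D (x - z t) + \<mu> * norm (x - z t) powr p"
  shows "F (z t) \<le> (1 - t) * F x + t * F y
    - \<mu> * (t powr p * (1 - t) + t * (1 - t) powr p) * norm (y - x) powr p"
proof -
  define N where "N = norm (y - x) powr p"
  have diffs: "y - z t = (1 - t) *\<^sub>R (y - x)" "x - z t = (- t) *\<^sub>R (y - x)"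
    by (simp_all add: z_def algebra_simps)
  have "F y - F (z t) \<ge> (1 - t) * inner D (y - x) + \<mu> * ((1 - t) powr p * N)"
    using to_y t unfolding diffs by (simp add: powr_mult N_def)
  then have 1: "t * ((1 - t) * inner D (y - x) + \<mu> * ((1 - t) powr p * N)) \<le> t * (F y - F (z t))"
    using t by (intro mult_left_mono)
  have "F x - F (z t) \<ge> - t * inner D (y - x) + \<mu> * (t powr p * N)"
    using to_x t unfolding diffs by (simp add: powr_mult N_def)
  then have "(1 - t) * (- t * inner D (y - x) + \<mu> * (t powr p * N)) \<le> (1 - t) * (F x - F (z t))"
    using t by (intro mult_left_mono) auto
  with 1 show ?thesis unfolding N_def[symmetric] by (simp add: algebra_simps)
qed

theorem theorem14:
  fixes g :: "'a::{real_inner, complete_space} \<Rightarrow> 'a"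
    and K :: "'a set"
    and F :: "'a \<Rightarrow> real"
    and p \<mu> :: real
  assumes "p > 1" and "\<mu> > 0"
    and "general_convex g K"
    and "K \<subseteq> range g"
    and "\<forall>x\<in>K. F differentiable (at x)"
  shows "higher_order_strongly_general_convex p \<mu> g K F \<longleftrightarrow>
    (\<forall>u v. g u \<in> K \<longrightarrow> g v \<in> K \<longrightarrow>
       F (g v) - F (g u)
         \<ge> inner (gradient F (g u)) (g v - g u) + \<mu> * norm (g v - g u) powr p)"
    (is "?strong \<longleftrightarrow> ?first_order")
proof
  assume strong: ?strong
  show ?first_order
  proof (intro allI impI)
    fix u v assume "g u \<in> K" "g v \<in> K"
    then have "GDERIV F (g u) :> gradient F (g u)"
      using assms(5) by (intro GDERIV_gradient) blast
    then show "F (g v) - F (g u)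
        \<ge> inner (gradient F (g u)) (g v - g u) + \<mu> * norm (g v - g u) powr p"
      using strong \<open>g u \<in> K\<close> \<open>g v \<in> K\<close> unfolding higher_order_strongly_general_convex_def
      by (intro gradient_inequality_of_segment_inequality[OF \<open>p > 1\<close>]) auto
  qed
next
  assume first_order: ?first_order
  show ?strong
    unfolding higher_order_strongly_general_convex_def
  proof (intro allI impI ballI)
    fix u v and t :: real
    assume K: "g u \<in> K" "g v \<in> K" and t: "t \<in> {0..1}"
    then have zK: "g u + t *\<^sub>R (g v - g u) \<in> K"
      using assms(3) unfolding general_convex_def by blast
    then obtain w where w: "g u + t *\<^sub>R (g v - g u) = g w"
      using assms(4) by blast
    show "F (g u + t *\<^sub>R (g v - g u)) \<le> (1 - t) * F (g u) + t * F (g v)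
        - \<mu> * (t powr p * (1 - t) + t * (1 - t) powr p) * norm (g v - g u) powr p"
      by (rule segment_inequality_of_gradient_inequalities[where D = "gradient F (g w)"])
         (use first_order K zK t in \<open>auto simp: w\<close>)
  qed
qed

end
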